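(* Let $\{X_i\}_{i\ge1}$ be i.i.d. real random variables with distribution $F$, and for $n\ge2$ let $T_n$ be the $t$-statistic of $X_1,\ldots,X_n$. Assume that $F$ decomposes as $F=F_d+F_c$, where $F_d$ is a discrete measure and $F_c$ is a continuous measure, and that $F_c\not\equiv 0$. Then, for any integer $n\ge 2$ and any real $r>0$, if $\mathrm{E}|T_n|^r$ is finite, then $r<n-1$.
   Context: For $n\ge2$ set $S_n=\sum_{i=1}^n X_i$ and $\hat\sigma_n^2=\frac{1}{n-1}\sum_{i=1}^n (X_i-n^{-1}S_n)^2$, with $\hat\sigma_n\ge 0$. The $t$-statistic is $T_n=n^{-1/2}\hat\sigma_n^{-1}S_n$ if $\hat\sigma_n>0$ and $T_n=0$ if $\hat\sigma_n=0$. A (nonnegative) measure on $\mathbb{R}$ is discrete if it is concentrated on a countable set, and continuous if it has no atoms (it is not required to be absolutely continuous). *)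

theory Defs
  imports "HOL-Probability.Probability"
begin

text \<open>Statistics are functions of a real sequence \<open>x\<close> of which only the entries
  \<open>x 1, \<dots>, x n\<close> are used; the random versions are obtained by taking \<open>x = (\<lambda>i. X i \<omega>)\<close>.\<close>

definition partial_sum :: "nat \<Rightarrow> (nat \<Rightarrow> real) \<Rightarrow> real" where
  "partial_sum n x = (\<Sum>i = 1..n. x i)"

definition sample_sd :: "nat \<Rightarrow> (nat \<Rightarrow> real) \<Rightarrow> real" where
  "sample_sd n x = sqrt (1 / (real n - 1) * (\<Sum>i = 1..n. (x i - partial_sum n x / real n)\<^sup>2))"

definition t_statistic :: "nat \<Rightarrow> (nat \<Rightarrow> real) \<Rightarrow> real" where
  "t_statistic n x =
     (if sample_sd n x > 0 then partial_sum n x / (sqrt (real n) * sample_sd n x) else 0)"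

text \<open>The condition on \<open>sets\<close> ensures that countable sets are measurable; without it,
  \<open>emeasure \<mu> {x} = 0\<close> would hold for every non-measurable singleton.\<close>

definition discrete_measure :: "real measure \<Rightarrow> bool" where
  "discrete_measure \<mu> \<longleftrightarrow> sets \<mu> = sets borel \<and> (\<exists>C. countable C \<and> (AE x in \<mu>. x \<in> C))"

definition continuous_measure :: "real measure \<Rightarrow> bool" where
  "continuous_measure \<mu> \<longleftrightarrow> sets \<mu> = sets borel \<and> (\<forall>x. emeasure \<mu> {x} = 0)"

end

theory Submission
  imports Defs "HOL-Real_Asymp.Real_Asymp"
begin

text \<open>Some ball around a nonzero point \<open>c\<close> carries an atomless piece of \<open>F\<close> of mass \<open>m > 0\<close>, and on it
  \<open>\<bar>S\<^sub>n\<bar>\<close> is bounded below. Cut the ball into \<open>N\<close> cells of equal length. All of \<open>X\<^sub>1, \<dots>, X\<^sub>n\<close> fall into a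
  common cell with probability at least \<open>m\<^sup>n N\<^sup>1\<^sup>-\<^sup>n\<close> by convexity of \<open>x \<mapsto> x\<^sup>n\<close>, and almost surely they
  are then not all equal, so that \<open>\<bar>T\<^sub>n\<bar> \<ge> N / 2\<close>. For \<open>r \<ge> n - 1\<close> this contradicts
  \<open>t P(\<bar>T\<^sub>n\<bar>\<^sup>r \<ge> t) \<rightarrow> 0\<close>, which holds whenever \<open>\<bar>T\<^sub>n\<bar>\<^sup>r\<close> is integrable.\<close>

lemma power_sum_le_card_sum_power:
  fixes p :: "'i \<Rightarrow> real"
  assumes "finite K" "K \<noteq> {}" "\<And>k. k \<in> K \<Longrightarrow> p k \<ge> 0" "n \<ge> 1"
  shows "(\<Sum>k\<in>K. p k) ^ n \<le> real (card K) ^ (n - 1) * (\<Sum>k\<in>K. p k ^ n)"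
proof -
  have c: "card K > 0" using assms by (simp add: card_gt_0_iff)
  have "((\<Sum>k\<in>K. (1 / real (card K)) *\<^sub>R p k)) ^ n \<le> (\<Sum>k\<in>K. (1 / real (card K)) * p k ^ n)"
  proof (rule convex_on_sum[where C = "{0..}" and f = "\<lambda>x::real. x ^ n"])
    show "convex_on {0..} (\<lambda>x::real. x ^ n)"
      by (cases "even n")
         (auto intro: convex_power_odd convex_on_subset[OF convex_power_even])
  qed (use assms c in auto)
  then have "((\<Sum>k\<in>K. p k) / real (card K)) ^ n \<le> (\<Sum>k\<in>K. p k ^ n) / real (card K)"
    by (simp flip: sum_divide_distrib)
  then have "(\<Sum>k\<in>K. p k) ^ n \<le> (\<Sum>k\<in>K. p k ^ n) / real (card K) * real (card K) ^ n"
    using c by (simp add: power_divide pos_divide_le_eq)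
  also have "\<dots> = real (card K) ^ (n - 1) * (\<Sum>k\<in>K. p k ^ n)"
    using c assms(4) by (cases n) auto
  finally show ?thesis .
qed

lemma integrable_imp_tail_tendsto_0:
  fixes Y :: "'a \<Rightarrow> real" and t :: "nat \<Rightarrow> real"
  assumes Y: "integrable M Y" and t: "filterlim t at_top sequentially"
  shows "(\<lambda>N. t N * measure M {\<omega> \<in> space M. t N \<le> Y \<omega>}) \<longlonglongrightarrow> 0"
proof -
  have m[measurable]: "Y \<in> borel_measurable M" using Y by auto
  have lim: "(\<lambda>N. \<integral>\<omega>. Y \<omega> * indicator {\<omega> \<in> space M. t N \<le> Y \<omega>} \<omega> \<partial>M) \<longlonglongrightarrow> (\<integral>\<omega>. 0 \<partial>M)"
  proof (rule integral_dominated_convergence[where w = "\<lambda>\<omega>. \<bar>Y \<omega>\<bar>"])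
    show "AE \<omega> in M. (\<lambda>N. Y \<omega> * indicator {\<omega> \<in> space M. t N \<le> Y \<omega>} \<omega>) \<longlonglongrightarrow> 0"
    proof (rule AE_I2)
      fix \<omega>
      have "eventually (\<lambda>N. t N > Y \<omega>) sequentially"
        using t by (simp add: filterlim_at_top_dense)
      then show "(\<lambda>N. Y \<omega> * indicator {\<omega> \<in> space M. t N \<le> Y \<omega>} \<omega>) \<longlonglongrightarrow> 0"
        by (intro tendsto_eventually, eventually_elim) simp
    qed
  qed (use Y in \<open>auto simp: indicator_def\<close>)
  have ev: "eventually (\<lambda>N. t N > 0) sequentially"
    using t by (simp add: filterlim_at_top_dense)
  show ?thesis
  proof (rule tendsto_sandwich[OF _ _ tendsto_const lim[simplified]])
    show "eventually (\<lambda>N. 0 \<le> t N * measure M {\<omega> \<in> space M. t N \<le> Y \<omega>}) sequentially"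
      using ev by eventually_elim auto
    show "eventually (\<lambda>N. t N * measure M {\<omega> \<in> space M. t N \<le> Y \<omega>}
        \<le> (\<integral>\<omega>. Y \<omega> * indicator {\<omega> \<in> space M. t N \<le> Y \<omega>} \<omega> \<partial>M)) sequentially"
      using ev
    proof eventually_elim
      case (elim N)
      let ?A = "{\<omega> \<in> space M. t N \<le> Y \<omega>}"
      have i: "integrable M (\<lambda>\<omega>. Y \<omega> * indicator ?A \<omega>)"
        by (rule Bochner_Integration.integrable_bound[OF Y]) (auto simp: indicator_def)
      have i2: "integrable M (\<lambda>\<omega>. indicator ?A \<omega> * t N :: real)"
        by (rule Bochner_Integration.integrable_bound[OF Y]) (use elim in \<open>auto simp: indicator_def\<close>)
      have "t N * measure M ?A = (\<integral>\<omega>. indicator ?A \<omega> * t N \<partial>M)"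
        by (simp add: Int_absorb2)
      also have "\<dots> \<le> (\<integral>\<omega>. Y \<omega> * indicator ?A \<omega> \<partial>M)"
        by (rule integral_mono[OF i2 i]) (auto simp: indicator_def)
      finally show ?case .
    qed
  qed
qed

lemma abs_t_statistic_ge:
  assumes n: "n \<ge> 2" and neq: "x 1 \<noteq> x 2"
    and a: "\<And>i. i \<in> {1..n} \<Longrightarrow> \<bar>x i - c\<bar> \<le> \<bar>c\<bar> / 2"
    and h: "\<And>i j. i \<in> {1..n} \<Longrightarrow> j \<in> {1..n} \<Longrightarrow> \<bar>x i - x j\<bar> \<le> h"
  shows "\<bar>t_statistic n x\<bar> \<ge> \<bar>c\<bar> / (2 * h)"
proof -
  define s where "s = partial_sum n x"
  have "\<bar>s - real n * c\<bar> = \<bar>\<Sum>i=1..n. x i - c\<bar>"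
    unfolding s_def partial_sum_def by (simp add: sum_subtractf)
  also have "\<dots> \<le> (\<Sum>i=1..n. \<bar>c\<bar> / 2)"
    by (rule order_trans[OF sum_abs sum_mono]) (use a in auto)
  finally have "\<bar>s - real n * c\<bar> \<le> real n * \<bar>c\<bar> / 2" by simp
  moreover have "real n * \<bar>c\<bar> = \<bar>real n * c\<bar>" by (simp add: abs_mult)
  ultimately have s: "real n * \<bar>c\<bar> / 2 \<le> \<bar>s\<bar>" by linarith
  have h0: "h > 0" using h[of 1 2] neq n by auto
  have dev: "\<bar>x i - s / real n\<bar> \<le> h" if i: "i \<in> {1..n}" for i
  proof -
    have "real n * \<bar>x i - s / real n\<bar> = \<bar>real n * (x i - s / real n)\<bar>"
      by (simp add: abs_mult)
    also have "real n * (x i - s / real n) = (\<Sum>j=1..n. x i - x j)"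
      using n by (simp add: s_def partial_sum_def sum_subtractf right_diff_distrib)
    also have "\<bar>\<dots>\<bar> \<le> (\<Sum>j=1..n. h)"
      by (rule order_trans[OF sum_abs sum_mono]) (use h i in auto)
    finally show ?thesis using n by simp
  qed
  define V where "V = (\<Sum>i=1..n. (x i - s / real n)\<^sup>2)"
  have "V \<le> (\<Sum>i=1..n. h\<^sup>2)"
    unfolding V_def by (rule sum_mono) (use dev h0 in \<open>auto simp: abs_le_square_iff[symmetric]\<close>)
  then have V: "V \<le> real n * h\<^sup>2" by simp
  have "V \<noteq> 0"
  proof
    assume "V = 0"
    then have "\<forall>i\<in>{1..n}. (x i - s / real n)\<^sup>2 = 0"
      unfolding V_def by (subst (asm) sum_nonneg_eq_0_iff) auto
    then have "x 1 = s / real n" "x 2 = s / real n" using n by auto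
    with neq show False by simp
  qed
  moreover have "V \<ge> 0" unfolding V_def by (intro sum_nonneg) auto
  ultimately have V0: "V > 0" by simp
  have sd: "sample_sd n x = sqrt (V / (real n - 1))"
    unfolding sample_sd_def V_def s_def by simp
  have sd0: "sample_sd n x > 0" unfolding sd using V0 n by simp
  have "V / (real n - 1) \<le> V / 1"
    by (rule divide_left_mono) (use V0 n in auto)
  then have "sample_sd n x \<le> sqrt (real n * h\<^sup>2)"
    unfolding sd using V by (intro real_sqrt_le_mono) auto
  also have "\<dots> = sqrt (real n) * h" using h0 by (simp add: real_sqrt_mult)
  finally have "sqrt (real n) * sample_sd n x \<le> sqrt (real n) * (sqrt (real n) * h)"
    by (intro mult_left_mono) auto
  then have den: "sqrt (real n) * sample_sd n x \<le> real n * h" by (simp flip: mult.assoc)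
  have "\<bar>c\<bar> / (2 * h) = (real n * \<bar>c\<bar> / 2) / (real n * h)"
    using n h0 by (simp add: field_simps)
  also have "\<dots> \<le> \<bar>s\<bar> / (sqrt (real n) * sample_sd n x)"
    by (rule frac_le) (use s den sd0 n in auto)
  also have "\<dots> = \<bar>t_statistic n x\<bar>"
    using sd0 by (simp add: t_statistic_def s_def abs_mult)
  finally show ?thesis .
qed

lemma ex_rat_near_nonzero:
  fixes y :: real
  assumes "y \<noteq> 0"
  shows "\<exists>q\<in>\<rat> - {0}. y \<in> ball q (\<bar>q\<bar> / 2)"
proof -
  have "y - \<bar>y\<bar> / 3 < y" using assms by auto
  then obtain q where q: "q \<in> \<rat>" "y - \<bar>y\<bar> / 3 < q" "q < y"
    using Rats_dense_in_real by blast
  have "y \<in> ball q (\<bar>q\<bar> / 2)" "q \<noteq> 0" using q assms by (auto simp: dist_real_def)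
  with q show ?thesis by blast
qed

lemma countable_null_set_continuous_measure:
  assumes "continuous_measure \<mu>" "countable C"
  shows "C \<in> null_sets \<mu>"
proof -
  have "(\<Union>x\<in>C. {x}) \<in> null_sets \<mu>"
    using assms by (intro null_sets_UN') (auto simp: continuous_measure_def null_sets_def)
  then show ?thesis by simp
qed

lemma atomless_set_near_nonzero:
  fixes F F\<^sub>d F\<^sub>c :: "real measure"
  assumes disc: "discrete_measure F\<^sub>d" and cont: "continuous_measure F\<^sub>c"
    and decomp: "\<And>A. A \<in> sets borel \<Longrightarrow> emeasure F A = emeasure F\<^sub>d A + emeasure F\<^sub>c A"
    and nonzero: "F\<^sub>c \<noteq> null_measure borel"
  obtains c B where "c \<noteq> 0" "B \<in> sets borel" "B \<subseteq> ball c (\<bar>c\<bar> / 2)" "emeasure F B > 0"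
    "\<And>y. y \<in> B \<Longrightarrow> emeasure F {y} = 0"
proof -
  obtain C where C: "countable C" "AE x in F\<^sub>d. x \<in> C"
    using disc by (auto simp: discrete_measure_def)
  have sd: "sets F\<^sub>d = sets borel" and sc: "sets F\<^sub>c = sets borel"
    using disc cont by (simp_all add: discrete_measure_def continuous_measure_def)
  have Cb[measurable]: "C \<in> sets borel" by (rule sets.countable[OF _ C(1)]) simp
  have "\<exists>q\<in>\<rat> - {0}. emeasure F\<^sub>c (ball q (\<bar>q\<bar> / 2)) > 0"
  proof (rule ccontr)
    assume "\<not> ?thesis"
    then have "ball q (\<bar>q\<bar> / 2) \<in> null_sets F\<^sub>c" if "q \<in> \<rat> - {0}" for q
      using that sc by (intro null_setsI) auto
    then have U: "(\<Union>q\<in>\<rat> - {0}. ball q (\<bar>q\<bar> / 2)) \<in> null_sets F\<^sub>c"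
      by (intro null_sets_UN') (auto intro: countable_rat)
    have "{0} \<in> null_sets F\<^sub>c"
      by (rule countable_null_set_continuous_measure[OF cont]) auto
    from null_sets.Un[OF this U] have "UNIV \<in> null_sets F\<^sub>c"
    proof (rule back_subst[where P = "\<lambda>S. S \<in> null_sets F\<^sub>c"])
      show "{0} \<union> (\<Union>q\<in>\<rat> - {0}. ball q (\<bar>q\<bar> / 2)) = (UNIV :: real set)"
        using ex_rat_near_nonzero by blast
    qed
    then have "emeasure F\<^sub>c A = 0" if "A \<in> sets F\<^sub>c" for A
      using that null_sets_subset by blast
    then have "F\<^sub>c = null_measure borel"
      using sc by (intro measure_eqI) auto
    with nonzero show False by simp
  qed
  then obtain c where c: "c \<noteq> 0" "emeasure F\<^sub>c (ball c (\<bar>c\<bar> / 2)) > 0" by auto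
  let ?B = "ball c (\<bar>c\<bar> / 2) - C"
  show thesis
  proof (rule that[of c ?B])
    have "emeasure F\<^sub>c ?B = emeasure F\<^sub>c (ball c (\<bar>c\<bar> / 2))"
      by (rule emeasure_Diff_null_set)
         (use countable_null_set_continuous_measure[OF cont C(1)] sc in auto)
    with c have "emeasure F\<^sub>c ?B > 0" by simp
    then show "emeasure F ?B > 0" using decomp[of ?B] by (simp add: add_pos_nonneg add_nonneg_pos)
    show "emeasure F {y} = 0" if y: "y \<in> ?B" for y
    proof -
      have "{y} \<in> null_sets F\<^sub>d"
      proof -
        have "AE x in F\<^sub>d. x \<notin> {y}" using C(2) by eventually_elim (use y in auto)
        then show ?thesis using sd by (subst AE_iff_null_sets) auto
      qed
      then show ?thesis
        using decomp[of "{y}"] cont by (auto simp: continuous_measure_def null_sets_def)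
    qed
  qed (use c in auto)
qed

lemma (in prob_space) AE_indep_var_neq:
  fixes Y Z :: "'a \<Rightarrow> real"
  assumes ind: "indep_var borel Y borel Z"
    and B: "B \<in> sets borel" and atom: "\<And>y. y \<in> B \<Longrightarrow> emeasure (distr M borel Z) {y} = 0"
  shows "AE \<omega> in M. \<not> (Y \<omega> = Z \<omega> \<and> Y \<omega> \<in> B)"
proof -
  note [measurable] = indep_var_rv1[OF ind] indep_var_rv2[OF ind] B
  interpret Z: prob_space "distr M borel Z" by (rule prob_space_distr) simp
  let ?D = "{p :: real \<times> real. fst p = snd p \<and> fst p \<in> B}"
  have D: "?D \<in> sets (distr M borel Y \<Otimes>\<^sub>M distr M borel Z)"
  proof -
    have "{p \<in> space (borel \<Otimes>\<^sub>M borel). fst p = snd p \<and> fst p \<in> B}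
        \<in> sets (borel \<Otimes>\<^sub>M borel :: (real \<times> real) measure)"
      by measurable
    then show ?thesis by (simp add: space_pair_measure cong: sets_pair_measure_cong)
  qed
  have "emeasure (distr M borel Y \<Otimes>\<^sub>M distr M borel Z) ?D
      = (\<integral>\<^sup>+y. emeasure (distr M borel Z) (Pair y -` ?D) \<partial>distr M borel Y)"
    by (rule Z.emeasure_pair_measure_alt[OF D])
  also have "\<dots> = (\<integral>\<^sup>+y. 0 \<partial>distr M borel Y)"
  proof (rule nn_integral_cong)
    fix y
    have "Pair y -` ?D = (if y \<in> B then {y} else {})" by auto
    then show "emeasure (distr M borel Z) (Pair y -` ?D) = 0" using atom by auto
  qed
  finally have "?D \<in> null_sets (distr M borel Y \<Otimes>\<^sub>M distr M borel Z)" using D by auto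
  then have "?D \<in> null_sets (distr M (borel \<Otimes>\<^sub>M borel) (\<lambda>\<omega>. (Y \<omega>, Z \<omega>)))"
    using indep_var_distribution_eq[THEN iffD1, OF ind] by simp
  then have "AE p in distr M (borel \<Otimes>\<^sub>M borel) (\<lambda>\<omega>. (Y \<omega>, Z \<omega>)). p \<notin> ?D"
    by (rule AE_not_in)
  then have "AE \<omega> in M. (Y \<omega>, Z \<omega>) \<notin> ?D"
    by (rule AE_distrD[rotated]) measurable
  then show ?thesis by simp
qed

lemma (in prob_space) indep_vars_imp_indep_var:
  assumes indep: "indep_vars M' X I" and ij: "i \<in> I" "j \<in> I" "i \<noteq> j"
  shows "indep_var (M' i) (X i) (M' j) (X j)"
proof -
  have "indep_var (M' i) ((\<lambda>f. f i) \<circ> (\<lambda>\<omega>. restrict (\<lambda>i. X i \<omega>) {i}))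
    (M' j) ((\<lambda>f. f j) \<circ> (\<lambda>\<omega>. restrict (\<lambda>i. X i \<omega>) {j}))"
    using ij by (intro indep_var_compose[OF indep_var_restrict[OF indep]]) auto
  then show ?thesis by (simp add: comp_def)
qed

lemma (in prob_space) prob_t_statistic_ge:
  fixes X :: "nat \<Rightarrow> 'a \<Rightarrow> real" and r :: real
  assumes indep: "indep_vars (\<lambda>_. borel) X {1..}"
    and ident: "\<And>i. i \<ge> 1 \<Longrightarrow> distr M borel (X i) = F"
    and c: "c \<noteq> 0" and B: "B \<in> sets borel" "B \<subseteq> ball c (\<bar>c\<bar> / 2)"
    and atom: "\<And>y. y \<in> B \<Longrightarrow> emeasure F {y} = 0"
    and n: "n \<ge> 2" and N: "N \<ge> (1::nat)"
    and meas: "{\<omega> \<in> space M. real N / 2 \<le> \<bar>t_statistic n (\<lambda>i. X i \<omega>)\<bar>} \<in> events"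
  shows "measure F B ^ n \<le>
    real N ^ (n - 1) * prob {\<omega> \<in> space M. real N / 2 \<le> \<bar>t_statistic n (\<lambda>i. X i \<omega>)\<bar>}"
proof -
  have X: "X i \<in> borel_measurable M" if "i \<ge> 1" for i
    using indep that by (auto simp: indep_vars_def)
  note [measurable] = B(1)
  interpret F: prob_space F
    using prob_space_distr[OF X[of 1]] ident[of 1] by simp
  have sF: "sets F = sets borel" using ident[of 1] by auto
  define cell where "cell y = \<lfloor>(y - (c - \<bar>c\<bar> / 2)) * real N / \<bar>c\<bar>\<rfloor>" for y
  have [measurable]: "cell \<in> borel \<rightarrow>\<^sub>M count_space UNIV"
    unfolding cell_def by measurable
  define I where "I k = {y \<in> B. cell y = int k}" for k
  have I[measurable]: "I k \<in> sets borel" for k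
  proof -
    have "{y \<in> space borel. y \<in> B \<and> cell y = int k} \<in> sets borel" by measurable
    then show ?thesis by (simp add: I_def)
  qed
  have UI: "B = (\<Union>k<N. I k)"
  proof (intro set_eqI iffI)
    fix y assume y: "y \<in> B"
    with B have y': "0 < y - (c - \<bar>c\<bar> / 2)" "y - (c - \<bar>c\<bar> / 2) < \<bar>c\<bar>"
      by (auto simp: dist_real_def abs_real_def split: if_splits)
    have "(y - (c - \<bar>c\<bar> / 2)) * real N < \<bar>c\<bar> * real N"
      using y' N by (intro mult_strict_right_mono) auto
    then have "cell y < int N" "0 \<le> cell y"
      using y' N c by (auto simp: cell_def floor_less_iff divide_less_eq mult.commute)
    with y have "y \<in> I (nat (cell y))" "nat (cell y) < N" by (auto simp: I_def)
    then show "y \<in> (\<Union>k<N. I k)" by auto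
  qed (auto simp: I_def)
  define E where "E k = {\<omega> \<in> space M. \<forall>i\<in>{1..n}. X i \<omega> \<in> I k}" for k
  have E: "E k \<in> events" for k
  proof -
    have "E k = (\<Inter>i\<in>{1..n}. X i -` I k \<inter> space M)" using n by (auto simp: E_def)
    also have "\<dots> \<in> events"
      using n by (intro sets.finite_INT measurable_sets[OF X]) auto
    finally show ?thesis .
  qed
  have pE: "prob (E k) = measure F (I k) ^ n" for k
  proof -
    have "E k = (\<Inter>i\<in>{1..n}. X i -` I k \<inter> space M)" using n by (auto simp: E_def)
    also have "prob \<dots> = (\<Prod>i\<in>{1..n}. prob (X i -` I k \<inter> space M))"
      by (rule indep_varsD[OF indep]) (use n in auto)
    also have "\<dots> = (\<Prod>i\<in>{1..n}. measure F (I k))"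
    proof (rule prod.cong[OF refl])
      fix i assume i: "i \<in> {1..n}"
      then have "measure F (I k) = measure (distr M borel (X i)) (I k)" using ident by simp
      then show "prob (X i -` I k \<inter> space M) = measure F (I k)"
        using i by (simp add: measure_distr X)
    qed
    finally show ?thesis by simp
  qed
  have "indep_var borel (X 1) borel (X 2)"
    by (rule indep_vars_imp_indep_var[OF indep]) auto
  then have ne: "AE \<omega> in M. \<not> (X 1 \<omega> = X 2 \<omega> \<and> X 1 \<omega> \<in> B)"
    by (rule AE_indep_var_neq) (use B atom ident[of 2] in auto)
  have "measure F B = (\<Sum>k<N. measure F (I k))"
    unfolding UI by (rule F.finite_measure_finite_Union) (auto simp: sF disjoint_family_on_def I_def)
  then have "measure F B ^ n \<le> real N ^ (n - 1) * (\<Sum>k<N. measure F (I k) ^ n)"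
    using power_sum_le_card_sum_power[of "{..<N}" "\<lambda>k. measure F (I k)" n] n N
    by (simp add: lessThan_empty_iff)
  also have "(\<Sum>k<N. measure F (I k) ^ n) = prob (\<Union>k<N. E k)"
  proof (subst finite_measure_finite_Union)
    show "disjoint_family_on E {..<N}"
      using n by (force simp: disjoint_family_on_def E_def I_def)
  qed (use E in \<open>auto simp: pE\<close>)
  also have "prob (\<Union>k<N. E k)
      \<le> prob {\<omega> \<in> space M. real N / 2 \<le> \<bar>t_statistic n (\<lambda>i. X i \<omega>)\<bar>}"
  proof (rule finite_measure_mono_AE[OF _ meas])
    show "AE \<omega> in M. \<omega> \<in> (\<Union>k<N. E k) \<longrightarrow>
        \<omega> \<in> {\<omega> \<in> space M. real N / 2 \<le> \<bar>t_statistic n (\<lambda>i. X i \<omega>)\<bar>}"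
      using ne
    proof (eventually_elim, intro impI)
      fix \<omega> assume w: "\<not> (X 1 \<omega> = X 2 \<omega> \<and> X 1 \<omega> \<in> B)" "\<omega> \<in> (\<Union>k<N. E k)"
      then obtain k where k: "\<omega> \<in> E k" by auto
      then have XI: "X i \<omega> \<in> I k" if "i \<in> {1..n}" for i using that by (auto simp: E_def)
      have "\<bar>c\<bar> / (2 * (\<bar>c\<bar> / real N)) \<le> \<bar>t_statistic n (\<lambda>i. X i \<omega>)\<bar>"
      proof (rule abs_t_statistic_ge[OF n])
        show "X 1 \<omega> \<noteq> X 2 \<omega>" using w XI[of 1] n by (auto simp: I_def)
        show "\<bar>X i \<omega> - c\<bar> \<le> \<bar>c\<bar> / 2" if "i \<in> {1..n}" for i
          using XI[OF that] B by (force simp: I_def dist_real_def abs_minus_commute)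
        show "\<bar>X i \<omega> - X j \<omega>\<bar> \<le> \<bar>c\<bar> / real N" if "i \<in> {1..n}" "j \<in> {1..n}" for i j
        proof -
          let ?f = "\<lambda>y. (y - (c - \<bar>c\<bar> / 2)) * real N / \<bar>c\<bar>"
          have "\<lfloor>?f (X i \<omega>)\<rfloor> = \<lfloor>?f (X j \<omega>)\<rfloor>"
            using XI[OF that(1)] XI[OF that(2)] by (simp add: I_def cell_def)
          then have "\<bar>?f (X i \<omega>) - ?f (X j \<omega>)\<bar> \<le> 1" by linarith
          also have "?f (X i \<omega>) - ?f (X j \<omega>) = (X i \<omega> - X j \<omega>) * (real N / \<bar>c\<bar>)"
            using c by (simp add: field_simps)
          finally have "\<bar>X i \<omega> - X j \<omega>\<bar> * (real N / \<bar>c\<bar>) \<le> 1" by (simp add: abs_mult)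
          then show ?thesis using c N by (simp add: pos_le_divide_eq pos_divide_le_eq)
        qed
      qed
      then show "\<omega> \<in> {\<omega> \<in> space M. real N / 2 \<le> \<bar>t_statistic n (\<lambda>i. X i \<omega>)\<bar>}"
        using c k by (auto simp: E_def)
    qed
  qed
  finally show ?thesis by (simp add: mult_left_mono)
qed

theorem theorem4p2:
  fixes M :: "'a measure" and X :: "nat \<Rightarrow> 'a \<Rightarrow> real"
    and F F\<^sub>d F\<^sub>c :: "real measure" and n :: nat and r :: real
  assumes "prob_space M"
    and indep: "prob_space.indep_vars M (\<lambda>_. borel) X {1..}"
    and ident: "\<And>i. i \<ge> 1 \<Longrightarrow> distr M borel (X i) = F"
    and disc: "discrete_measure F\<^sub>d"
    and cont: "continuous_measure F\<^sub>c"
    and decomp: "\<And>A. A \<in> sets borel \<Longrightarrow> emeasure F A = emeasure F\<^sub>d A + emeasure F\<^sub>c A"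
    and nonzero: "F\<^sub>c \<noteq> null_measure borel"
    and "n \<ge> 2" and "r > 0"
    and finite_moment: "integrable M (\<lambda>\<omega>. \<bar>t_statistic n (\<lambda>i. X i \<omega>)\<bar> powr r)"
  shows "r < real n - 1"
proof (rule ccontr)
  assume "\<not> r < real n - 1"
  then have r: "r \<ge> real (n - 1)" using \<open>n \<ge> 2\<close> by (simp add: of_nat_diff)
  interpret prob_space M by fact
  obtain c B where cB: "c \<noteq> 0" "B \<in> sets borel" "B \<subseteq> ball c (\<bar>c\<bar> / 2)" "emeasure F B > 0"
    "\<And>y. y \<in> B \<Longrightarrow> emeasure F {y} = 0"
    using atomless_set_near_nonzero[OF disc cont decomp nonzero] by blast
  have "X 1 \<in> borel_measurable M" using indep by (auto simp: indep_vars_def)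
  then interpret F: prob_space F using prob_space_distr[of "X 1" borel] ident[of 1] by simp
  have mB: "measure F B > 0" using cB(4) F.emeasure_eq_measure[of B] by simp
  let ?T = "\<lambda>\<omega>. \<bar>t_statistic n (\<lambda>i. X i \<omega>)\<bar>"
  let ?t = "\<lambda>N. (real N / 2) powr r"
  have "filterlim ?t at_top sequentially" using \<open>r > 0\<close> by real_asymp
  from integrable_imp_tail_tendsto_0[OF finite_moment this]
  have lim: "(\<lambda>N. ?t N * prob {\<omega> \<in> space M. ?t N \<le> ?T \<omega> powr r}) \<longlonglongrightarrow> 0" .
  have low: "(1/2) powr r * measure F B ^ n \<le> ?t N * prob {\<omega> \<in> space M. ?t N \<le> ?T \<omega> powr r}"
    if N: "N \<ge> 1" for N
  proof -
    have "?t N \<le> ?T \<omega> powr r \<longleftrightarrow> real N / 2 \<le> ?T \<omega>" for \<omega>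
      using \<open>r > 0\<close> powr_mono2[of r "real N / 2" "?T \<omega>"] powr_less_mono2[of r "?T \<omega>" "real N / 2"]
      by fastforce
    then have eq: "{\<omega> \<in> space M. ?t N \<le> ?T \<omega> powr r} = {\<omega> \<in> space M. real N / 2 \<le> ?T \<omega>}"
      by simp
    have "{\<omega> \<in> space M. ?t N \<le> ?T \<omega> powr r} \<in> events"
      using borel_measurable_integrable[OF finite_moment] by measurable
    then have "measure F B ^ n \<le> real N ^ (n - 1) * prob {\<omega> \<in> space M. real N / 2 \<le> ?T \<omega>}"
      using cB \<open>n \<ge> 2\<close> N by (intro prob_t_statistic_ge[OF indep ident]) (auto simp: eq)
    also have "real N ^ (n - 1) \<le> real N powr r"
      using N r by (simp add: powr_mono flip: powr_realpow)
    finally have "measure F B ^ n \<le> real N powr r * prob {\<omega> \<in> space M. real N / 2 \<le> ?T \<omega>}"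
      by (simp add: mult_right_mono)
    then have "(1/2) powr r * measure F B ^ n
        \<le> (1/2) powr r * (real N powr r * prob {\<omega> \<in> space M. real N / 2 \<le> ?T \<omega>})"
      by (intro mult_left_mono) auto
    also have "\<dots> = ?t N * prob {\<omega> \<in> space M. ?t N \<le> ?T \<omega> powr r}"
      unfolding eq by (simp add: powr_divide)
    finally show ?thesis .
  qed
  have "(1/2) powr r * measure F B ^ n \<le> 0"
    by (rule LIMSEQ_le_const[OF lim]) (use low in blast)
  moreover have "(1/2) powr r * measure F B ^ n > 0" using mB by simp
  ultimately show False by simp
qed

end
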